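(* For any $m\in\mathbb N$, $\Lambda_{\mathscr F_m,\overline{\mathcal P}_{\le m}}\le 2$. Furthermore, for any $\delta\in(0,\frac12]$ there exist a bid history $\mathcal H$ and a valuation vector $\mathbf v$ such that $\Lambda_{\mathscr F_m,\overline{\mathcal P}_{\le m}}(\mathcal H,\mathbf v)\ge 2-\delta$. Thus the richness ratio of the class $\mathscr F_m$ is $\alpha=1/2$.
   Context: Uniform price auction with $K$ identical units, repeated over a finite bid history $\mathcal H=[\boldsymbol\beta_-^t]_{t\in[T]}$ of competing bids. A bidder has valuation $\mathbf v$: $v_1\ge\dots\ge v_M>0$, $w_j=\frac1j\sum_{\ell\le j}v_\ell$. An $m$-uniform strategy $\langle(b_1,q_1),\dots,(b_m,q_m)\rangle$ ($b_1>\dots>b_m>0$, positive integer $q_j$, $Q_j=\sum_{\ell\le j}q_\ell\le M$) is the bid vector with $q_1$ copies of $b_1$, then $q_2$ copies of $b_2$, etc. With competing bids $\boldsymbol\beta_-$, the $K$ highest bids win a unit each (ties in favor of the bidder), $x$ is the bidder's number of winning bids, the per-unit price $p$ is the $K$-th highest bid, $V(\mathbf b;\boldsymbol\beta_-)=\sum_{j\le x}v_j$, $P=px$. $\overline{\mathcal P}_{\le m}$ is the set of $k$-uniform strategies, $k\le m$, with $b_\ell=w_{Q_\ell}$ for all $\ell$. $\mathscr F_m=\mathscr F_m(\mathcal H)$ is the class of $k$-uniform strategies with $k\le m$ that are RoI feasible ($V\ge P$) in every round of $\mathcal H$. For classes $\mathscr B_c,\mathscr B$: $\Lambda_{\mathscr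 B_c,\mathscr B}(\mathcal H,\mathbf v)=\frac{\max_{\mathbf b\in\mathscr B_c}\sum_tV(\mathbf b;\boldsymbol\beta_-^t)}{\max_{\mathbf b'\in\mathscr B}\sum_tV(\mathbf b';\boldsymbol\beta_-^t)}$, and $\Lambda_{\mathscr B_c,\mathscr B}$ is the supremum over all valuation vectors and all bid histories of arbitrary length. If $\Lambda_{\mathscr B_c,\mathscr B}\le\lambda$ and for every small $\delta>0$ some $(\mathcal H,\mathbf v)$ attains $\Lambda(\mathcal H,\mathbf v)\ge\lambda-\delta$, the richness ratio of $\mathscr B_c$ (relative to $\mathscr B=\overline{\mathcal P}_{\le m}$) is $\alpha=1/\lambda$. *)

theory Defs
  imports Complex_Main "HOL-Library.Extended_Real"
begin

text \<open>A strategy is the list of its pairs \<open>(b\<^sub>l, q\<^sub>l)\<close>; valuation vectors, bid vectors and the competing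
  bids of a round are lists of reals, and a history is a list of rounds.\<close>

type_synonym strategy = "(real \<times> nat) list"
type_synonym history = "real list list"

definition bid_vector :: "strategy \<Rightarrow> real list" where
  "bid_vector s = concat (map (\<lambda>(b, q). replicate q b) s)"

definition cum_quantity :: "strategy \<Rightarrow> nat \<Rightarrow> nat" where
  "cum_quantity s l = (\<Sum>i<l. snd (s ! i))"

definition uniform_strategy :: "nat \<Rightarrow> nat \<Rightarrow> strategy \<Rightarrow> bool" where
  "uniform_strategy M k s \<longleftrightarrow>
     1 \<le> k \<and> length s = k \<and> sorted_wrt (>) (map fst s) \<and>
     (\<forall>(b, q) \<in> set s. 0 < b \<and> 0 < q) \<and> cum_quantity s k \<le> M"

definition valuation :: "real list \<Rightarrow> bool" where
  "valuation v \<longleftrightarrow> v \<noteq> [] \<and> sorted_wrt (\<ge>) v \<and> (\<forall>y \<in> set v. 0 < y)"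

definition avg_value :: "real list \<Rightarrow> nat \<Rightarrow> real" where
  "avg_value v j = sum_list (take j v) / real j"

text \<open>All bids of a round in decreasing order, tagged by whether they are the bidder's own. Since
  \<open>sort_key\<close> is stable and the own bids are listed first, ties are broken in favour of the bidder.\<close>

definition ranked_bids :: "real list \<Rightarrow> real list \<Rightarrow> (real \<times> bool) list" where
  "ranked_bids bs cs =
     sort_key (\<lambda>(c, _). - c) (map (\<lambda>b. (b, True)) bs @ map (\<lambda>c. (c, False)) cs)"

definition units_won :: "nat \<Rightarrow> strategy \<Rightarrow> real list \<Rightarrow> nat" where
  "units_won K s cs = length (filter snd (take K (ranked_bids (bid_vector s) cs)))"

text \<open>If fewer than \<open>K\<close> bids are submitted in total, the missing ones count as zero bids.\<close>

definition price :: "nat \<Rightarrow> strategy \<Rightarrow> real list \<Rightarrow> real" where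
  "price K s cs =
     (let r = ranked_bids (bid_vector s) cs in if K \<le> length r then fst (r ! (K - 1)) else 0)"

definition value_won :: "nat \<Rightarrow> real list \<Rightarrow> strategy \<Rightarrow> real list \<Rightarrow> real" where
  "value_won K v s cs = sum_list (take (units_won K s cs) v)"

definition payment :: "nat \<Rightarrow> strategy \<Rightarrow> real list \<Rightarrow> real" where
  "payment K s cs = price K s cs * real (units_won K s cs)"

definition total_value :: "nat \<Rightarrow> history \<Rightarrow> real list \<Rightarrow> strategy \<Rightarrow> real" where
  "total_value K H v s = (\<Sum>cs\<leftarrow>H. value_won K v s cs)"

text \<open>An instance consists of the number of units \<open>K\<close>, a history and a valuation vector, whose
  length is \<open>M\<close>; a class of strategies may depend on all of these.\<close>

type_synonym strategy_class = "nat \<Rightarrow> history \<Rightarrow> real list \<Rightarrow> strategy set"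

definition auction_instance :: "nat \<Rightarrow> history \<Rightarrow> real list \<Rightarrow> bool" where
  "auction_instance K H v \<longleftrightarrow>
     1 \<le> K \<and> H \<noteq> [] \<and> (\<forall>cs \<in> set H. \<forall>c \<in> set cs. 0 \<le> c) \<and> valuation v"

definition safe_class :: "nat \<Rightarrow> strategy_class" where
  "safe_class m K H v =
     {s. \<exists>k \<le> m. uniform_strategy (length v) k s \<and>
           (\<forall>l < k. fst (s ! l) = avg_value v (cum_quantity s (Suc l)))}"

definition feasible_class :: "nat \<Rightarrow> strategy_class" where
  "feasible_class m K H v =
     {s. \<exists>k \<le> m. uniform_strategy (length v) k s \<and>
           (\<forall>cs \<in> set H. payment K s cs \<le> value_won K v s cs)}"

text \<open>The totals range over a finite set even when the class is infinite, so \<open>Max\<close> is meaningful.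
  The quotient is taken in \<^typ>\<open>ereal\<close>, where \<open>a / 0 = \<infinity>\<close> for \<open>a > 0\<close> and \<open>0 / 0 = 0\<close>; hence
  degenerate histories with ratio \<open>0 / 0\<close> do not affect the supremum below.\<close>

definition value_ratio ::
  "strategy_class \<Rightarrow> strategy_class \<Rightarrow> nat \<Rightarrow> history \<Rightarrow> real list \<Rightarrow> ereal" where
  "value_ratio Bc B K H v =
     ereal (Max (total_value K H v ` Bc K H v)) / ereal (Max (total_value K H v ` B K H v))"

definition sup_value_ratio :: "strategy_class \<Rightarrow> strategy_class \<Rightarrow> ereal" where
  "sup_value_ratio Bc B =
     Sup {value_ratio Bc B K H v | K H v. auction_instance K H v}"

definition richness_ratio :: "strategy_class \<Rightarrow> strategy_class \<Rightarrow> real \<Rightarrow> bool" where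
  "richness_ratio Bc B \<alpha> \<longleftrightarrow>
     (\<exists>r > 0. sup_value_ratio Bc B \<le> ereal r \<and>
        (\<forall>\<^sub>F \<delta> in at_right 0.
           \<exists>K H v. auction_instance K H v \<and> ereal (r - \<delta>) \<le> value_ratio Bc B K H v) \<and>
        \<alpha> = 1 / r)"

end

(*
  In a round in which a feasible strategy wins part of a block of equal bids, the price is that bid;
  in every other round it wins complete blocks only. Feasibility bounds the price by the average
  value of the units won, so the rounds of the first kind can be served by the safe strategy that uses
  the largest partially won quantity of each block, and those of the second kind by the safe strategy
  with the original quantities. The better of the two collects at least half of the value.

  For tightness, consider 2m scales of quantities growing by a factor N, each responsible for the
  same total value. A feasible strategy pairs up consecutive scales in its m blocks and collects all of
  them, whereas each of the m blocks of a safe strategy serves one scale only, up to a factor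
  1 + O(1/N).
*)
theory Submission
  imports Defs "HOL-Library.Multiset"
begin

subsection \<open>Clearing of a single round\<close>

lemma length_ranked_bids [simp]: "length (ranked_bids bs cs) = length bs + length cs"
  by (simp add: ranked_bids_def)

lemma length_filter_ranked_bids:
  "length (filter P (ranked_bids bs cs)) =
     length (filter (\<lambda>b. P (b, True)) bs) + length (filter (\<lambda>c. P (c, False)) cs)"
proof -
  have "mset (filter P (ranked_bids bs cs)) =
      mset (filter P (map (\<lambda>b. (b, True)) bs @ map (\<lambda>c. (c, False)) cs))"
    unfolding ranked_bids_def by (simp only: mset_filter mset_sort)
  then have "length (filter P (ranked_bids bs cs)) =
      length (filter P (map (\<lambda>b. (b, True)) bs @ map (\<lambda>c. (c, False)) cs))"
    by (metis size_mset)
  then show ?thesis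
    by (simp add: filter_map o_def)
qed

lemma sorted_split_three:
  fixes f :: "'a \<Rightarrow> 'b::linorder"
  assumes "sorted (map f xs)"
  shows "xs = filter (\<lambda>x. f x < a) xs @ filter (\<lambda>x. f x = a) xs @ filter (\<lambda>x. a < f x) xs"
  using assms
proof (induction xs)
  case (Cons y ys)
  have ge: "\<forall>x\<in>set ys. f y \<le> f x"
    using Cons.prems by simp
  show ?case
  proof (cases "f y" a rule: linorder_cases)
    case less
    then show ?thesis using Cons by auto
  next
    case equal
    then have "filter (\<lambda>x. f x < a) ys = []"
      using ge by (auto simp: filter_empty_conv)
    then show ?thesis using Cons equal by auto
  next
    case greater
    then have "filter (\<lambda>x. f x < a) ys = []" "filter (\<lambda>x. f x = a) ys = []"
      using ge by (auto simp: filter_empty_conv)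
    then show ?thesis using Cons greater by auto
  qed
qed simp

text \<open>The sort key is the negated bid and the sort is stable, so bids equal to
  \<open>a\<close> keep their original order, own bids first. This is where tie-breaking in favour
  of the bidder enters.\<close>

lemma ranked_bids_split:
  "ranked_bids bs cs =
     filter (\<lambda>x. a < fst x) (ranked_bids bs cs)
     @ map (\<lambda>b. (b, True)) (filter (\<lambda>b. b = a) bs) @ map (\<lambda>c. (c, False)) (filter (\<lambda>c. c = a) cs)
     @ filter (\<lambda>x. fst x < a) (ranked_bids bs cs)"
proof -
  let ?f = "\<lambda>(c, _::bool). - c :: real"
  let ?xs = "map (\<lambda>b. (b, True)) bs @ map (\<lambda>c. (c, False)) cs"
  have "sorted (map ?f (ranked_bids bs cs))"
    unfolding ranked_bids_def by (rule sorted_sort_key)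
  moreover have "filter (\<lambda>x. ?f x = - a) (ranked_bids bs cs) = filter (\<lambda>x. ?f x = - a) ?xs"
    unfolding ranked_bids_def by (rule sort_key_stable)
  moreover have "filter (\<lambda>x. ?f x = - a) ?xs =
      map (\<lambda>b. (b, True)) (filter (\<lambda>b. b = a) bs) @ map (\<lambda>c. (c, False)) (filter (\<lambda>c. c = a) cs)"
    by (simp add: filter_map o_def)
  ultimately show ?thesis
    using sorted_split_three[of ?f "ranked_bids bs cs" "- a"] by (simp add: case_prod_unfold)
qed

lemma length_filter_take_le: "length (filter P (take n xs)) \<le> length (filter P xs)"
  by (metis append_take_drop_id filter_append le_add1 length_append)

lemma length_filter_mono:
  assumes "\<And>x. x \<in> set xs \<Longrightarrow> P x \<Longrightarrow> Q x"
  shows "length (filter P xs) \<le> length (filter Q xs)"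
  using assms by (induction xs) auto

lemma length_filter_snd_compl:
  "length (filter snd xs) + length (filter (\<lambda>x. \<not> snd x) xs) = length xs"
  by (rule sum_length_filter_compl)

lemma length_filter_le_split:
  fixes bs :: "real list"
  shows "length (filter (\<lambda>b. a \<le> b) bs) =
    length (filter (\<lambda>b. a < b) bs) + length (filter (\<lambda>b. b = a) bs)"
  by (induction bs) auto

text \<open>All bids above \<open>a\<close> followed by the own bids equal to \<open>a\<close> form
  a prefix of the ranking whose only rivals bid above \<open>a\<close>. If this prefix has at least
  \<open>K\<close> entries, only those rivals can take units away; otherwise every own bid of at
  least \<open>a\<close> wins.\<close>

lemma units_won_ge:
  assumes own: "x \<le> length (filter (\<lambda>b. a \<le> b) (bid_vector s))"
    and rival: "x + length (filter (\<lambda>c. a < c) cs) \<le> K"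
  shows "x \<le> units_won K s cs"
proof -
  let ?bs = "bid_vector s"
  let ?r = "ranked_bids ?bs cs"
  let ?A = "filter (\<lambda>x. a < fst x) ?r"
  let ?E = "map (\<lambda>b. (b, True)) (filter (\<lambda>b. b = a) ?bs)"
  define pre where "pre = ?A @ ?E"
  have "\<exists>post. ?r = pre @ post"
    using ranked_bids_split[of ?bs cs a] unfolding pre_def by (metis append.assoc)
  then obtain post where r: "?r = pre @ post" ..
  have own_pre: "length (filter snd pre) = length (filter (\<lambda>b. a \<le> b) ?bs)"
    unfolding pre_def length_filter_le_split
    by (simp add: length_filter_ranked_bids filter_map o_def conj_commute)
  have rival_pre: "length (filter (\<lambda>x. \<not> snd x) pre) = length (filter (\<lambda>c. a < c) cs)"
    unfolding pre_def by (simp add: length_filter_ranked_bids filter_map o_def)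
  show ?thesis
  proof (cases "K \<le> length pre")
    case True
    then have "take K ?r = take K pre" "length (take K pre) = K"
      by (simp_all add: r)
    moreover have "length (filter (\<lambda>x. \<not> snd x) (take K pre)) \<le> length (filter (\<lambda>c. a < c) cs)"
      using length_filter_take_le rival_pre by metis
    ultimately show ?thesis
      using length_filter_snd_compl[of "take K pre"] rival unfolding units_won_def by simp
  next
    case False
    then have "take K ?r = pre @ take (K - length pre) post"
      by (simp add: r)
    then show ?thesis
      using own own_pre unfolding units_won_def by simp
  qed
qed

text \<open>The price is the \<open>K\<close>-th highest bid, so every bid strictly above it is
  among the first \<open>K\<close> and no bid below it is. Each inequality counts own or rival bids
  relative to this cut.\<close>

lemma market_clearing:
  fixes K :: nat and s :: strategy and cs :: "real list"
  defines "p \<equiv> price K s cs" and "x \<equiv> units_won K s cs"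
  assumes K: "1 \<le> K" and nonneg: "\<forall>b\<in>set (bid_vector s). 0 \<le> b"
  shows own_above_price: "length (filter (\<lambda>b. p < b) (bid_vector s)) \<le> x"
    and own_from_price: "x \<le> length (filter (\<lambda>b. p \<le> b) (bid_vector s))"
    and rivals_above_price: "x + length (filter (\<lambda>c. p < c) cs) \<le> K"
    and rivals_from_price:
      "K \<le> length (bid_vector s) + length cs \<Longrightarrow> K \<le> x + length (filter (\<lambda>c. p \<le> c) cs)"
    and bids_above_price:
      "length (filter (\<lambda>b. p < b) (bid_vector s)) + length (filter (\<lambda>c. p < c) cs) < K"
proof -
  let ?bs = "bid_vector s"
  let ?r = "ranked_bids ?bs cs"
  have "length (filter (\<lambda>b. p < b) ?bs) \<le> x \<and> x \<le> length (filter (\<lambda>b. p \<le> b) ?bs)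
    \<and> x + length (filter (\<lambda>c. p < c) cs) \<le> K
    \<and> (K \<le> length ?bs + length cs \<longrightarrow> K \<le> x + length (filter (\<lambda>c. p \<le> c) cs))
    \<and> length (filter (\<lambda>b. p < b) ?bs) + length (filter (\<lambda>c. p < c) cs) < K"
  proof (cases "K \<le> length ?r")
    \<comment> \<open>With fewer than \<open>K\<close> bids the price defaults to \<open>0\<close>
      and every bid wins; nonnegativity puts all own bids at or above that price.\<close>
    case False
    then have "p = 0" "take K ?r = ?r"
      by (auto simp: p_def price_def)
    then have "x = length ?bs"
      by (simp add: x_def units_won_def length_filter_ranked_bids)
    moreover have "filter (\<lambda>b. p \<le> b) ?bs = ?bs"
      using nonneg \<open>p = 0\<close> by simp
    moreover have "length (filter (\<lambda>b. p < b) ?bs) \<le> length ?bs"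
      "length (filter (\<lambda>c. p < c) cs) \<le> length cs"
      by simp_all
    ultimately show ?thesis
      using False by (auto simp del: length_filter_le)
  next
    case True
    then have p: "p = fst (?r ! (K - 1))"
      by (simp add: p_def price_def)
    let ?A = "filter (\<lambda>x. p < fst x) ?r"
    let ?E = "map (\<lambda>b. (b, True)) (filter (\<lambda>b. b = p) ?bs) @ map (\<lambda>c. (c, False)) (filter (\<lambda>c. c = p) cs)"
    let ?B = "filter (\<lambda>x. fst x < p) ?r"
    have r: "?r = ?A @ ?E @ ?B"
      using ranked_bids_split[of ?bs cs p] by simp
    \<comment> \<open>The next two claims place position \<open>K - 1\<close>, counted from
      \<open>0\<close>, inside the block \<open>?E\<close> of bids equal to \<open>p\<close>: the
      entry there is neither above nor below \<open>p\<close>.\<close>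
    have lenA: "length ?A < K"
    proof (rule ccontr)
      assume "\<not> length ?A < K"
      then have lt: "K - 1 < length ?A" using K by simp
      then have "?r ! (K - 1) = ?A ! (K - 1)"
        by (subst r) (rule nth_append_left)
      then have "?r ! (K - 1) \<in> set ?A"
        using nth_mem[OF lt] by simp
      then show False using p by simp
    qed
    have lenE: "K \<le> length (?A @ ?E)"
    proof (rule ccontr)
      assume less: "\<not> K \<le> length (?A @ ?E)"
      have lenr: "length ?r = length (?A @ ?E) + length ?B"
        using arg_cong[OF r, of length] by (simp only: length_append add.assoc)
      have lt: "K - 1 - length (?A @ ?E) < length ?B"
        using less lenr True K by linarith
      have "?r ! (K - 1) = ((?A @ ?E) @ ?B) ! (K - 1)"
        using r by (simp only: append.assoc)
      also have "\<dots> = ?B ! (K - 1 - length (?A @ ?E))"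
        using less by (intro nth_append_right) linarith
      finally have "?r ! (K - 1) = ?B ! (K - 1 - length (?A @ ?E))" .
      then have "?r ! (K - 1) \<in> set ?B"
        using nth_mem[OF lt] by simp
      then show False using p by simp
    qed
    have take1: "take K ?r = ?A @ take (K - length ?A) (?E @ ?B)"
      using arg_cong[OF r, of "take K"] lenA by (simp only: take_append) simp
    have take2: "take K ?r = take K (?A @ ?E)"
    proof -
      have "take K ?r = take K ((?A @ ?E) @ ?B)"
        using r by (simp only: append.assoc)
      also have "\<dots> = take K (?A @ ?E)"
        using lenE by (simp only: take_append[of K "?A @ ?E"]) simp
      finally show ?thesis .
    qed
    \<comment> \<open>The first \<open>K\<close> entries contain \<open>?A\<close> and are contained
      in \<open>?A @ ?E\<close>; this squeezes the own and the rival counts alike.\<close>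
    have lower: "length (filter P ?A) \<le> length (filter P (take K ?r))" for P
      unfolding take1 filter_append length_append by simp
    have upper: "length (filter P (take K ?r)) \<le> length (filter P (?A @ ?E))" for P
      unfolding take2 by (rule length_filter_take_le)
    have x: "x = length (filter snd (take K ?r))"
      by (simp add: x_def units_won_def)
    have xK: "x + length (filter (\<lambda>y. \<not> snd y) (take K ?r)) = K"
      using length_filter_snd_compl[of "take K ?r"] True unfolding x by simp
    have counts: "length (filter snd ?A) = length (filter (\<lambda>b. p < b) ?bs)"
      "length (filter (\<lambda>y. \<not> snd y) ?A) = length (filter (\<lambda>c. p < c) cs)"
      by (simp_all add: length_filter_ranked_bids)
    have counts': "length (filter snd (?A @ ?E)) = length (filter (\<lambda>b. p \<le> b) ?bs)"
      "length (filter (\<lambda>y. \<not> snd y) (?A @ ?E)) = length (filter (\<lambda>c. p \<le> c) cs)"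
      unfolding filter_append length_append length_filter_le_split
      by (simp_all add: length_filter_ranked_bids filter_map o_def)
    show ?thesis
      using lower[of snd] lower[of "\<lambda>y. \<not> snd y"] upper[of snd] upper[of "\<lambda>y. \<not> snd y"]
        xK lenA length_filter_snd_compl[of ?A]
      unfolding counts counts' x[symmetric] by linarith
  qed
  then show "length (filter (\<lambda>b. p < b) ?bs) \<le> x" "x \<le> length (filter (\<lambda>b. p \<le> b) ?bs)"
    "x + length (filter (\<lambda>c. p < c) cs) \<le> K"
    "K \<le> length ?bs + length cs \<Longrightarrow> K \<le> x + length (filter (\<lambda>c. p \<le> c) cs)"
    "length (filter (\<lambda>b. p < b) ?bs) + length (filter (\<lambda>c. p < c) cs) < K"
    by blast+
qed

text \<open>A price below \<open>a\<close> would put all these rivals strictly above the price,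
  where fewer than \<open>K\<close> bids lie.\<close>

lemma price_ge:
  assumes "1 \<le> K" "\<forall>b\<in>set (bid_vector s). 0 \<le> b"
    and rivals: "K \<le> length (filter (\<lambda>c. a \<le> c) cs)"
  shows "a \<le> price K s cs"
proof (rule ccontr)
  assume "\<not> a \<le> price K s cs"
  then have "length (filter (\<lambda>c. a \<le> c) cs) \<le> length (filter (\<lambda>c. price K s cs < c) cs)"
    by (intro length_filter_mono) auto
  then show False
    using rivals bids_above_price[OF assms(1,2), of cs] by linarith
qed

subsection \<open>Strategies\<close>

lemma bid_vector_Nil [simp]: "bid_vector [] = []"
  by (simp add: bid_vector_def)

lemma bid_vector_Cons [simp]: "bid_vector ((b, q) # s) = replicate q b @ bid_vector s"
  by (simp add: bid_vector_def)

lemma bid_vector_append [simp]: "bid_vector (s @ s') = bid_vector s @ bid_vector s'"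
  by (simp add: bid_vector_def)

lemma set_bid_vector_subset: "set (bid_vector s) \<subseteq> fst ` set s"
  by (force simp: bid_vector_def)

lemma length_bid_vector: "length (bid_vector s) = cum_quantity s (length s)"
proof (induction s rule: rev_induct)
  case (snoc x s)
  have "(\<Sum>i<length s. snd ((s @ [x]) ! i)) = (\<Sum>i<length s. snd (s ! i))"
    by (intro sum.cong) (auto simp: nth_append)
  then show ?case
    using snoc by (cases x) (simp add: cum_quantity_def)
qed (simp add: cum_quantity_def)

lemma cum_quantity_append:
  "l \<le> length s \<Longrightarrow> cum_quantity (s @ s') l = cum_quantity s l"
  unfolding cum_quantity_def by (intro sum.cong) (auto simp: nth_append)

lemma sorted_bid_vector:
  "sorted_wrt (>) (map fst s) \<Longrightarrow> sorted_wrt (\<ge>) (bid_vector s)"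
proof (induction s)
  case (Cons x s)
  have "\<forall>b\<in>set (bid_vector s). b < fst x"
    using Cons.prems set_bid_vector_subset[of s] by auto
  moreover have "sorted_wrt (\<ge>) (replicate n b)" for n and b :: real
    by (induction n) auto
  ultimately show ?case
    using Cons
    by (cases x) (auto simp: sorted_wrt_append)
qed simp

text \<open>In a descending list an upward closed predicate holds exactly on an initial segment, so
  its count tells where it stops.\<close>

lemma sorted_nth_iff_less_length_filter:
  fixes bs :: "'a::linorder list"
  assumes "sorted_wrt (\<ge>) bs" "\<And>a b. P a \<Longrightarrow> a \<le> b \<Longrightarrow> P b" "n < length bs"
  shows "P (bs ! n) \<longleftrightarrow> n < length (filter P bs)"
  using assms(1,3)
proof (induction bs arbitrary: n)
  case (Cons b bs)
  show ?case
  proof (cases "P b")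
    case True
    then show ?thesis using Cons by (cases n) auto
  next
    case False
    then have "\<forall>y\<in>set (b # bs). \<not> P y"
      using Cons.prems assms(2) by auto
    moreover from this have "filter P (b # bs) = []"
      by (simp add: filter_empty_conv)
    ultimately show ?thesis
      using Cons.prems nth_mem by (metis length_greater_0_conv less_nat_zero_code list.size(3))
  qed
qed simp

lemma uniform_strategyD:
  assumes "uniform_strategy M k s"
  shows "length s = k" "1 \<le> k" "length (bid_vector s) \<le> M" "bid_vector s \<noteq> []"
    "\<forall>b\<in>set (bid_vector s). 0 < b" "sorted_wrt (\<ge>) (bid_vector s)"
proof -
  show "length s = k" "1 \<le> k" "length (bid_vector s) \<le> M" "sorted_wrt (\<ge>) (bid_vector s)"
    using assms by (auto simp: uniform_strategy_def length_bid_vector intro: sorted_bid_vector)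
  show "\<forall>b\<in>set (bid_vector s). 0 < b"
    using assms set_bid_vector_subset[of s] by (fastforce simp: uniform_strategy_def)
  show "bid_vector s \<noteq> []"
    using assms by (cases s) (auto simp: uniform_strategy_def)
qed

text \<open>The elements of \<open>S\<close> become the ends of the blocks. They are added in
  increasing order: a new largest \<open>q\<close> appends a block at bid \<open>w q\<close> that
  fills the gap between the current total and \<open>q\<close>. The \<open>0\<close> in
  \<open>insert 0 S\<close> covers the empty strategy.\<close>

lemma exists_strategy_with_cum_quantities:
  fixes w :: "nat \<Rightarrow> real"
  assumes "finite S" "0 \<notin> S" "\<And>q q'. q \<in> S \<Longrightarrow> q' \<in> S \<Longrightarrow> q < q' \<Longrightarrow> w q' < w q"
  shows "\<exists>s. sorted_wrt (>) (map fst s) \<and> (\<forall>(b, q)\<in>set s. 0 < q) \<and> fst ` set s \<subseteq> w ` S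
    \<and> length s = card S \<and> (\<forall>l<length s. fst (s ! l) = w (cum_quantity s (Suc l)))
    \<and> length (bid_vector s) \<in> insert 0 S
    \<and> (\<forall>q\<in>S. q \<le> length (filter (\<lambda>b. w q \<le> b) (bid_vector s)))"
  using assms
proof (induction rule: finite_linorder_max_induct)
  case empty
  show ?case
    by (intro exI[of _ "[]"]) simp
next
  case (insert q A)
  obtain s where s: "sorted_wrt (>) (map fst s)" "\<forall>(b, q)\<in>set s. 0 < q" "fst ` set s \<subseteq> w ` A"
    "length s = card A" "\<forall>l<length s. fst (s ! l) = w (cum_quantity s (Suc l))"
    "length (bid_vector s) \<in> {0} \<union> A"
    "\<forall>q\<in>A. q \<le> length (filter (\<lambda>b. w q \<le> b) (bid_vector s))"
    using insert.IH insert.prems by auto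
  have "length (bid_vector s) < q"
    using s(6) insert.hyps(2) insert.prems(1) by auto
  then have q: "length (bid_vector s) + (q - length (bid_vector s)) = q" "0 < q - length (bid_vector s)"
    by simp_all
  have above: "\<forall>b\<in>fst ` set s. w q < b"
    using s(3) insert.hyps(2) insert.prems(2) by (fastforce dest!: subsetD)
  then have "filter (\<lambda>b. w q \<le> b) (bid_vector s) = bid_vector s"
    using set_bid_vector_subset[of s] by (force intro!: filter_True)
  moreover have "fst (s' ! l) = w (cum_quantity s' (Suc l))"
    if "l < Suc (length s)" "s' = s @ [(w q, q - length (bid_vector s))]" for l s'
  proof (cases "l < length s")
    case True
    then show ?thesis
      using that s(5) by (simp add: nth_append cum_quantity_append)
  next
    case False
    then have "l = length s" using that by simp
    moreover have "cum_quantity s' (length s') = q"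
      using q(1) unfolding length_bid_vector[symmetric] that(2) by simp
    ultimately show ?thesis using that(2) by simp
  qed
  moreover have "q \<notin> A" using insert.hyps(2) by auto
  ultimately show ?case
    using s q above insert.hyps(1)
    by (intro exI[of _ "s @ [(w q, q - length (bid_vector s))]"])
       (auto simp: sorted_wrt_append intro: trans_le_add1)
qed

lemma avg_value_pos:
  assumes "valuation v" "1 \<le> q"
  shows "0 < avg_value v q"
proof -
  have "take q v \<noteq> []" "\<forall>y\<in>set (take q v). 0 < y"
    using assms by (auto simp: valuation_def dest: in_set_takeD)
  then have "0 < sum_list (take q v)"
    by (cases "take q v") (auto intro!: add_pos_nonneg sum_list_nonneg)
  then show ?thesis
    using assms by (simp add: avg_value_def)
qed

text \<open>Quantities whose average value does not exceed that of a larger quantity in \<open>S\<close> would destroy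
  strict monotonicity of the bids, but they are dominated and can be dropped.\<close>

lemma exists_safe_strategy:
  assumes v: "valuation v" and S: "S \<subseteq> {1..length v}" "card S \<le> m" and m: "1 \<le> m"
  shows "\<exists>s\<in>safe_class m K H v.
    \<forall>q\<in>S. q \<le> length (filter (\<lambda>b. avg_value v q \<le> b) (bid_vector s))"
proof -
  define w where "w = avg_value v"
  \<comment> \<open>A strategy must have at least one block, so an empty \<open>S\<close> is
    replaced by the single quantity \<open>1\<close>.\<close>
  define S1 where "S1 = (if S = {} then {1} else S)"
  have S1: "finite S1" "S1 \<noteq> {}" "S1 \<subseteq> {1..length v}" "card S1 \<le> m"
    using S m v finite_subset[OF S(1)] by (auto simp: S1_def valuation_def Suc_le_eq)
  define S2 where "S2 = {q \<in> S1. \<forall>q'\<in>S1. q < q' \<longrightarrow> w q' < w q}"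
  have fin: "finite S2" and sub: "S2 \<subseteq> S1"
    using S1(1) by (auto simp: S2_def)
  \<comment> \<open>Among the quantities of at least \<open>q\<close> with average at least
    \<open>w q\<close>, the largest survives in \<open>S2\<close>: a still larger element of
    \<open>S1\<close> with no smaller average would belong to the same set.\<close>
  have dom: "\<exists>q'\<in>S2. q \<le> q' \<and> w q \<le> w q'" if "q \<in> S1" for q
  proof -
    let ?D = "{q' \<in> S1. q \<le> q' \<and> w q \<le> w q'}"
    have D: "finite ?D" "?D \<noteq> {}" using S1(1) that by auto
    then have "Max ?D \<in> ?D" by (rule Max_in)
    moreover have "w q' < w (Max ?D)" if "q' \<in> S1" "Max ?D < q'" for q'
    proof (rule ccontr)
      assume "\<not> w q' < w (Max ?D)"
      then have "q' \<in> ?D" using that \<open>Max ?D \<in> ?D\<close> by auto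
      then show False using Max_ge[OF D(1)] that(2) by fastforce
    qed
    ultimately show ?thesis unfolding S2_def by blast
  qed
  obtain s where s: "sorted_wrt (>) (map fst s)" "\<forall>(b, q)\<in>set s. 0 < q" "fst ` set s \<subseteq> w ` S2"
    "length s = card S2" "\<forall>l<length s. fst (s ! l) = w (cum_quantity s (Suc l))"
    "length (bid_vector s) \<in> insert 0 S2"
    "\<forall>q\<in>S2. q \<le> length (filter (\<lambda>b. w q \<le> b) (bid_vector s))"
  proof -
    have "0 \<notin> S2" using S1(3) sub by auto
    moreover have "w q' < w q" if "q \<in> S2" "q' \<in> S2" "q < q'" for q q'
      using that by (simp add: S2_def)
    ultimately show ?thesis
      using exists_strategy_with_cum_quantities[OF fin, of w] that by auto
  qed
  have "S2 \<noteq> {}" using dom S1(2) by blast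
  then have "1 \<le> card S2" using fin by (simp add: Suc_le_eq card_gt_0_iff)
  moreover have "card S2 \<le> m" using card_mono[OF S1(1) sub] S1(4) by simp
  moreover have "0 < b" if "(b, q) \<in> set s" for b q
  proof -
    have "b \<in> w ` S2"
      using s(3) that by force
    then show ?thesis
      using sub S1(3) avg_value_pos[OF v] by (auto simp: w_def)
  qed
  moreover have "cum_quantity s (length s) \<le> length v"
    using s(6) sub S1(3) by (auto simp: length_bid_vector)
  ultimately have "s \<in> safe_class m K H v"
    using s by (auto simp: safe_class_def uniform_strategy_def w_def)
  moreover have "q \<le> length (filter (\<lambda>b. w q \<le> b) (bid_vector s))" if "q \<in> S" for q
  proof -
    have "q \<in> S1" using that by (auto simp: S1_def)
    then obtain q' where q': "q' \<in> S2" "q \<le> q'" "w q \<le> w q'"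
      using dom by blast
    have "length (filter (\<lambda>b. w q' \<le> b) (bid_vector s)) \<le> length (filter (\<lambda>b. w q \<le> b) (bid_vector s))"
      using q'(3) by (intro length_filter_mono) auto
    then show ?thesis using q' s(7) by (meson le_trans)
  qed
  ultimately show ?thesis unfolding w_def by blast
qed

subsection \<open>Upper bound\<close>

lemma sum_list_take_mono:
  assumes "valuation v" "x \<le> y"
  shows "sum_list (take x v) \<le> sum_list (take y v)"
proof -
  have "take y v = take x v @ take (y - x) (drop x v)"
    using assms(2) by (metis le_add_diff_inverse take_add)
  moreover have "0 \<le> sum_list (take (y - x) (drop x v))"
    using assms(1) by (intro sum_list_nonneg) (auto simp: valuation_def less_imp_le dest!: in_set_takeD in_set_dropD)
  ultimately show ?thesis by simp
qed

lemma value_won_nonneg: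
  assumes "valuation v"
  shows "0 \<le> value_won K v s cs"
  using sum_list_take_mono[OF assms, of 0] by (simp add: value_won_def)

lemma total_value_nonneg:
  assumes "valuation v"
  shows "0 \<le> total_value K H v s"
  unfolding total_value_def by (rule sum_list_nonneg) (auto intro: value_won_nonneg[OF assms])

lemma feasible_price_le_avg_value:
  assumes "payment K s cs \<le> value_won K v s cs" "0 < units_won K s cs"
  shows "price K s cs \<le> avg_value v (units_won K s cs)"
  using assms by (simp add: payment_def value_won_def avg_value_def field_simps)

text \<open>No more rivals outbid \<open>a\<close> than outbid \<open>p\<close>, so the room for
  \<open>x\<close> units at price \<open>p\<close> is still there for a strategy with
  \<open>q\<close> bids of at least \<open>a\<close>. It is applied with \<open>p\<close> the price
  faced by the feasible strategy and \<open>a\<close> an average value.\<close>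

lemma units_won_ge_of_avg_value:
  assumes clear: "x + length (filter (\<lambda>c. p < c) cs) \<le> K" and p: "p \<le> a"
    and x: "x \<le> q" "q \<le> length (filter (\<lambda>b. a \<le> b) (bid_vector s))"
  shows "x \<le> units_won K s cs"
proof (rule units_won_ge)
  have "length (filter (\<lambda>c. a < c) cs) \<le> length (filter (\<lambda>c. p < c) cs)"
    using p by (intro length_filter_mono) auto
  then show "x + length (filter (\<lambda>c. a < c) cs) \<le> K"
    using clear by linarith
  show "x \<le> length (filter (\<lambda>b. a \<le> b) (bid_vector s))"
    using x by simp
qed

lemma total_value_le_two_safe:
  assumes inst: "auction_instance K H v" and m: "1 \<le> m" and s: "s \<in> feasible_class m K H v"
  shows "\<exists>a\<in>safe_class m K H v. \<exists>b\<in>safe_class m K H v.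
    total_value K H v s \<le> total_value K H v a + total_value K H v b"
proof -
  have K: "1 \<le> K" and v: "valuation v"
    using inst by (auto simp: auction_instance_def)
  obtain k where k: "k \<le> m" "uniform_strategy (length v) k s"
    and feas: "\<And>cs. cs \<in> set H \<Longrightarrow> payment K s cs \<le> value_won K v s cs"
    using s by (auto simp: feasible_class_def)
  define bs where "bs = bid_vector s"
  define x where "x = units_won K s"
  define p where "p = price K s"
  note U = uniform_strategyD[OF k(2), folded bs_def]
  have nonneg: "\<forall>b\<in>set (bid_vector s). 0 \<le> b" using U(5) by (auto simp: bs_def less_imp_le)
  note clear = market_clearing[OF K nonneg, folded bs_def x_def p_def]
  have x_le: "x cs \<le> length bs" for cs
    using clear(2)[of cs] length_filter_le[of "\<lambda>b. p cs \<le> b" bs] by linarith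
  have price: "p cs \<le> avg_value v (x cs)" if "cs \<in> set H" "0 < x cs" for cs
    using feasible_price_le_avg_value feas that by (simp add: p_def x_def)
  \<comment> \<open>The ends of the blocks: with indices from \<open>0\<close>,
    \<open>bs ! (n - 1)\<close> is the last of the first \<open>n\<close> bids and
    \<open>bs ! n\<close> is the next one.\<close>
  define A where "A = {n \<in> {1..length bs}. n = length bs \<or> bs ! n \<noteq> bs ! (n - 1)}"
  \<comment> \<open>\<open>T b\<close> collects the quantities won that stop inside the block of bid
    \<open>b\<close>; \<open>B\<close> keeps the largest one per block.\<close>
  define T where "T b = {x cs | cs. cs \<in> set H \<and> 0 < x cs \<and> x cs \<notin> A \<and> bs ! (x cs - 1) = b}" for b
  define B where "B = (\<lambda>b. Max (T b)) ` {b \<in> set bs. T b \<noteq> {}}"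
  have T_sub: "T b \<subseteq> {1..length bs}" for b
    using x_le by (auto simp: T_def)
  then have finT: "finite (T b)" for b by (rule finite_subset) simp
  have card_bs: "card (set bs) \<le> m"
  proof -
    have "card (set bs) \<le> card (fst ` set s)"
      unfolding bs_def by (intro card_mono set_bid_vector_subset) simp
    also have "\<dots> \<le> length s"
      by (metis card_length list.set_map length_map)
    finally show ?thesis using U(1) k(1) by simp
  qed
  \<comment> \<open>The bid strictly drops after a block end, so different ends have different last
    bids and there are at most as many ends as distinct bids.\<close>
  have "inj_on (\<lambda>n. bs ! (n - 1)) A"
  proof (rule linorder_inj_onI')
    fix i j assume ij: "i \<in> A" "j \<in> A" "i < j"
    then have i: "1 \<le> i" "j \<le> length bs" "bs ! i \<noteq> bs ! (i - 1)"
      by (auto simp: A_def)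
    have desc: "bs ! l' \<le> bs ! l" if "l \<le> l'" "l' < length bs" for l l'
      using sorted_wrt_nth_less[OF U(6), of l l'] that by (cases "l = l'") auto
    have "bs ! i \<le> bs ! (i - 1)" "bs ! (j - 1) \<le> bs ! i"
      using i ij(3) by (auto intro!: desc)
    then show "bs ! (i - 1) \<noteq> bs ! (j - 1)"
      using i(3) by linarith
  qed
  then have "card A \<le> card (set bs)"
    by (rule card_inj_on_le) (auto simp: A_def)
  then obtain a where a: "a \<in> safe_class m K H v"
    "\<forall>q\<in>A. q \<le> length (filter (\<lambda>b. avg_value v q \<le> b) (bid_vector a))"
    using exists_safe_strategy[OF v _ _ m, of A K H] card_bs U(3) by (force simp: A_def)
  have "card B \<le> card {b \<in> set bs. T b \<noteq> {}}"
    unfolding B_def by (intro card_image_le) simp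
  also have "\<dots> \<le> card (set bs)"
    by (intro card_mono) auto
  finally have "card B \<le> m" using card_bs by simp
  moreover have "B \<subseteq> {1..length v}"
    using T_sub Max_in[OF finT] U(3) unfolding B_def by fastforce
  ultimately obtain b where b: "b \<in> safe_class m K H v"
    "\<forall>q\<in>B. q \<le> length (filter (\<lambda>b. avg_value v q \<le> b) (bid_vector b))"
    using exists_safe_strategy[OF v _ _ m, of B K H] by auto
  \<comment> \<open>The last winning and the first losing own bid coincide; the price is at most the
    former and at least the latter.\<close>
  have partial_price: "p cs = bs ! (x cs - 1)" if "0 < x cs" "x cs \<notin> A" for cs
  proof -
    have less: "x cs < length bs" and eq: "bs ! x cs = bs ! (x cs - 1)"
      using that x_le[of cs] by (auto simp: A_def)
    have "p cs \<le> bs ! (x cs - 1)"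
      using sorted_nth_iff_less_length_filter[OF U(6), of "\<lambda>b. p cs \<le> b" "x cs - 1"]
        clear(2)[of cs] that less by auto
    moreover have "\<not> p cs < bs ! x cs"
      using sorted_nth_iff_less_length_filter[OF U(6), of "\<lambda>b. p cs < b" "x cs"]
        clear(1)[of cs] less by auto
    ultimately show ?thesis using eq by simp
  qed
  have round: "value_won K v s cs \<le> value_won K v a cs + value_won K v b cs" if cs: "cs \<in> set H" for cs
  proof -
    consider "x cs = 0" | "x cs \<in> A" | "0 < x cs" "x cs \<notin> A" by auto
    then have "x cs \<le> units_won K a cs \<or> x cs \<le> units_won K b cs"
    proof cases
      case 1
      then show ?thesis by simp
    next
      case 2
      then have "x cs \<le> units_won K a cs"
        using a(2) price[OF cs] clear(3)[of cs]
        by (intro units_won_ge_of_avg_value[where p = "p cs" and q = "x cs"]) (auto simp: A_def)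
      then show ?thesis ..
    next
      case 3
      let ?\<beta> = "bs ! (x cs - 1)"
      have xT: "x cs \<in> T ?\<beta>" using 3 cs by (auto simp: T_def)
      then have M: "Max (T ?\<beta>) \<in> T ?\<beta>" "x cs \<le> Max (T ?\<beta>)"
        using finT by (auto intro: Max_in)
      then obtain cs' where cs': "cs' \<in> set H" "Max (T ?\<beta>) = x cs'" "0 < x cs'" "x cs' \<notin> A"
        "bs ! (x cs' - 1) = ?\<beta>"
        unfolding T_def by blast
      \<comment> \<open>Both \<open>cs\<close> and \<open>cs'\<close> stop inside the same block, so
        both have price \<open>?\<beta>\<close>; feasibility in \<open>cs'\<close> bounds it by the
        average at the larger quantity.\<close>
      have "p cs \<le> avg_value v (Max (T ?\<beta>))"
        using price[OF cs'(1,3)] partial_price[OF cs'(3,4)] partial_price[OF 3] cs'(2,5) by simp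
      moreover have "?\<beta> \<in> set bs"
        using 3 x_le[of cs] by (intro nth_mem) linarith
      then have "Max (T ?\<beta>) \<in> B"
        using xT unfolding B_def by blast
      ultimately have "x cs \<le> units_won K b cs"
        using b(2) M(2) clear(3)[of cs]
        by (intro units_won_ge_of_avg_value[where p = "p cs" and q = "Max (T ?\<beta>)"]) auto
      then show ?thesis ..
    qed
    then show ?thesis
      using sum_list_take_mono[OF v] value_won_nonneg[OF v, of K a cs] value_won_nonneg[OF v, of K b cs]
      unfolding value_won_def x_def by (smt (verit))
  qed
  have "total_value K H v s \<le> (\<Sum>cs\<leftarrow>H. value_won K v a cs + value_won K v b cs)"
    unfolding total_value_def using round by (rule sum_list_mono)
  also have "\<dots> = total_value K H v a + total_value K H v b"
    unfolding total_value_def by (rule sum_list_addf)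
  finally show ?thesis using a(1) b(1) by blast
qed

text \<open>At most \<open>K\<close> units are won in a round, so a round has at most
  \<open>K + 1\<close> possible values. This gives \<open>Max\<close> its meaning over infinite
  classes.\<close>

lemma finite_total_values: "finite (total_value K H v ` C)"
proof -
  define X where "X = (\<lambda>n. sum_list (take n v)) ` {..K}"
  have "units_won K s cs \<le> K" for s cs
    using le_trans[OF length_filter_le[of snd "take K (ranked_bids (bid_vector s) cs)"]]
    by (simp add: units_won_def)
  then have "value_won K v s cs \<in> X" for s cs
    by (auto simp: value_won_def X_def)
  then have "total_value K H v ` C \<subseteq> sum_list ` {xs. set xs \<subseteq> X \<and> length xs = length H}"
    unfolding total_value_def by (auto intro!: imageI)
  moreover have "finite X"
    by (simp add: X_def)
  ultimately show ?thesis
    using finite_lists_length_eq finite_surj by blast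
qed

text \<open>A single bid equal to the first valuation can win only at a price not above the value of
  that unit.\<close>

lemma feasible_class_nonempty:
  assumes inst: "auction_instance K H v" and m: "1 \<le> m"
  shows "feasible_class m K H v \<noteq> {}"
proof -
  have K: "1 \<le> K" and v: "valuation v" using inst by (auto simp: auction_instance_def)
  obtain y ys where ys: "v = y # ys" "0 < y"
    using v by (cases v) (auto simp: valuation_def)
  let ?s = "[(y, 1)]"
  have "payment K ?s cs \<le> value_won K v ?s cs" for cs
  proof -
    have "\<forall>b\<in>set (bid_vector ?s). 0 \<le> b" using ys by simp
    from own_from_price[OF K this, of cs] show ?thesis
      using ys(1) by (cases "units_won K ?s cs")
        (auto simp: payment_def value_won_def split: if_splits)
  qed
  then have "?s \<in> feasible_class m K H v"
    using m ys by (auto simp: feasible_class_def uniform_strategy_def cum_quantity_def intro!: exI[of _ 1])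
  then show ?thesis by blast
qed

lemma value_ratio_le_2:
  assumes inst: "auction_instance K H v" and m: "1 \<le> m"
  shows "value_ratio (feasible_class m) (safe_class m) K H v \<le> 2"
proof -
  define F where "F = Max (total_value K H v ` feasible_class m K H v)"
  define S where "S = Max (total_value K H v ` safe_class m K H v)"
  have v: "valuation v" using inst by (simp add: auction_instance_def)
  have "F \<in> total_value K H v ` feasible_class m K H v"
    unfolding F_def using feasible_class_nonempty[OF assms] finite_total_values by (intro Max_in) auto
  then obtain s where s: "s \<in> feasible_class m K H v" "F = total_value K H v s" by blast
  then obtain a b where ab: "a \<in> safe_class m K H v" "b \<in> safe_class m K H v"
    "F \<le> total_value K H v a + total_value K H v b"
    using total_value_le_two_safe[OF assms] by blast
  have le: "total_value K H v c \<le> S" if "c \<in> safe_class m K H v" for c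
    unfolding S_def using finite_total_values that by (intro Max_ge) auto
  have F: "F \<le> 2 * S" "0 \<le> F" "0 \<le> S"
    using ab le[OF ab(1)] le[OF ab(2)] total_value_nonneg[OF v, of K H a]
      total_value_nonneg[OF v, of K H s] s(2) by linarith+
  have "ereal F / ereal S \<le> 2"
  proof (cases "S = 0")
    \<comment> \<open>Here \<open>F\<close> is forced to be \<open>0\<close> as well, and
      \<open>0 / 0 = 0\<close> in \<open>ereal\<close>.\<close>
    case True
    then show ?thesis using F by (simp add: zero_ereal_def[symmetric])
  next
    case False
    then have "ereal F / ereal S = ereal (F / S)" by simp
    also have "\<dots> \<le> ereal 2" using False F by (simp only: ereal_less_eq) (simp add: divide_le_eq)
    finally show ?thesis by simp
  qed
  then show ?thesis by (simp add: value_ratio_def F_def S_def)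
qed

subsection \<open>Lower bound\<close>

lemma length_filter_bid_vector:
  "length (filter P (bid_vector s)) = (\<Sum>l<length s. if P (fst (s ! l)) then snd (s ! l) else 0)"
proof (induction s rule: rev_induct)
  case (snoc x s)
  have "(\<Sum>l<length s. if P (fst ((s @ [x]) ! l)) then snd ((s @ [x]) ! l) else 0) =
      (\<Sum>l<length s. if P (fst (s ! l)) then snd (s ! l) else 0)"
    by (intro sum.cong) (auto simp: nth_append)
  then show ?case
    using snoc by (cases x) simp
qed simp

lemma total_value_concat_replicate:
  "total_value K (concat (map (\<lambda>i. replicate (n i) (r i)) xs)) v s =
     (\<Sum>i\<leftarrow>xs. real (n i) * value_won K v s (r i))"
  by (induction xs) (auto simp: total_value_def sum_list_replicate)

text \<open>If the last partial sum is at most \<open>z\<close>, all terms together are bounded by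
  it; otherwise the last term vanishes. With block sizes for \<open>q\<close> this bounds the number
  of safe bids that reach a threshold.\<close>

lemma sum_small_partial_sums_le:
  fixes q :: "nat \<Rightarrow> nat"
  shows "(\<Sum>l<k. if sum q {..<Suc l} \<le> z then q l else 0) \<le> z"
proof (induction k)
  case (Suc k)
  show ?case
  proof (cases "sum q {..<Suc k} \<le> z")
    case True
    have "(\<Sum>l<Suc k. if sum q {..<Suc l} \<le> z then q l else 0) \<le> sum q {..<Suc k}"
      by (intro sum_mono) auto
    then show ?thesis using True by linarith
  next
    case False
    then show ?thesis using Suc by simp
  qed
qed simp

text \<open>The \<open>- 1\<close> makes \<open>level N i\<close> units worth exactly
  \<open>N ^ i\<close> for \<open>i\<close> from \<open>1\<close> to \<open>2 * m\<close>, since the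
  first unit of the valuation below counts double.\<close>

definition level :: "nat \<Rightarrow> nat \<Rightarrow> nat" where
  "level N i = N ^ i - 1"

text \<open>The extra value of the first unit makes the average of \<open>q\<close> units equal to
  \<open>1 + 1 / q\<close>, which is strictly decreasing and at most \<open>2\<close>.\<close>

definition hard_valuation :: "nat \<Rightarrow> nat \<Rightarrow> real list" where
  "hard_valuation N m = 2 # replicate (N ^ (2 * m) - 2) 1"

text \<open>The break-even price for winning \<open>level N i\<close> units.\<close>

definition threshold :: "nat \<Rightarrow> nat \<Rightarrow> nat \<Rightarrow> real" where
  "threshold N m i = avg_value (hard_valuation N m) (level N i)"

text \<open>In an odd round only \<open>level N i\<close> units are available below the prohibitive bid \<open>3\<close>; in an
  even round all are, so that a rival bid sets the price.\<close>

definition hard_round :: "nat \<Rightarrow> nat \<Rightarrow> nat \<Rightarrow> real list" where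
  "hard_round N m i =
     (if even i then replicate (N ^ (2 * m)) (threshold N m i)
      else replicate (N ^ (2 * m) - level N i) 3 @ replicate (level N i) (threshold N m i))"

text \<open>The multiplicity \<open>N ^ (2 * m - i)\<close> balances the value \<open>N ^ i\<close>,
  so that every scale is worth \<open>N ^ (2 * m)\<close> in total.\<close>

definition hard_history :: "nat \<Rightarrow> nat \<Rightarrow> history" where
  "hard_history N m =
     concat (map (\<lambda>i. replicate (N ^ (2 * m - i)) (hard_round N m i)) [1..<Suc (2 * m)])"

text \<open>Block \<open>j\<close> extends to the quantity of scale \<open>2 * j + 2\<close> but
  bids the higher break-even price of scale \<open>2 * j + 1\<close>. In the odd round it is won
  partially at its own bid; in the even round it is won completely and a lower rival bid sets the
  price.\<close>

definition paired_strategy :: "nat \<Rightarrow> nat \<Rightarrow> strategy" where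
  "paired_strategy N m =
     map (\<lambda>j. (threshold N m (2 * j + 1), level N (2 * j + 2) - level N (2 * j))) [0..<m]"

context
  fixes N m :: nat
  assumes N: "2 \<le> N" and m: "1 \<le> m"
begin

section \<open>Values, scales and thresholds of the hard instance\<close>

lemma two_le_units: "2 \<le> N ^ (2 * m)"
proof -
  have "2 \<le> N ^ 1" using N by simp
  also have "\<dots> \<le> N ^ (2 * m)" using N m by (intro power_increasing) auto
  finally show ?thesis .
qed

lemma length_hard_valuation: "length (hard_valuation N m) = N ^ (2 * m) - 1"
  using two_le_units by (simp add: hard_valuation_def)

lemma valuation_hard_valuation: "valuation (hard_valuation N m)"
proof -
  have "sorted_wrt (\<ge>) (replicate n (1::real))" for n
    by (induction n) auto
  then show ?thesis by (simp add: valuation_def hard_valuation_def)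
qed

lemma sum_take_hard_valuation:
  assumes "1 \<le> q" "q < N ^ (2 * m)"
  shows "sum_list (take q (hard_valuation N m)) = real q + 1"
proof -
  obtain q' where q': "q = Suc q'" using assms by (cases q) auto
  then have "min q' (N ^ (2 * m) - 2) = q'" using assms by linarith
  then show ?thesis by (simp add: q' hard_valuation_def sum_list_replicate)
qed

lemma sum_take_hard_valuation_le: "sum_list (take q (hard_valuation N m)) \<le> real q + 1"
  by (cases q) (auto simp: hard_valuation_def sum_list_replicate)

lemma avg_hard_valuation:
  assumes "1 \<le> q" "q < N ^ (2 * m)"
  shows "avg_value (hard_valuation N m) q = 1 + 1 / real q"
  using assms by (simp add: avg_value_def sum_take_hard_valuation add_divide_distrib)

lemma avg_hard_valuation_le_iff:
  assumes "1 \<le> q" "q < N ^ (2 * m)" "1 \<le> q'" "q' < N ^ (2 * m)"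
  shows "avg_value (hard_valuation N m) q \<le> avg_value (hard_valuation N m) q' \<longleftrightarrow> q' \<le> q"
  using assms by (simp add: avg_hard_valuation divide_le_cancel field_simps)

lemma Suc_level: "Suc (level N i) = N ^ i"
  using N by (simp add: level_def)

lemma real_level: "real (level N i) + 1 = real N ^ i"
  using arg_cong[OF Suc_level, of real i] by simp

lemma level_0 [simp]: "level N 0 = 0"
  by (simp add: level_def)

lemma level_less_iff: "level N i < level N j \<longleftrightarrow> i < j"
proof -
  have "level N i < level N j \<longleftrightarrow> N ^ i < N ^ j"
    by (simp flip: Suc_level)
  then show ?thesis using N by simp
qed

lemma level_le_iff: "level N i \<le> level N j \<longleftrightarrow> i \<le> j"
  using level_less_iff[of j i] by (simp add: not_less[symmetric])

lemma level_bounds: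
  assumes "i \<in> {1..2 * m}"
  shows "1 \<le> level N i" "level N i < N ^ (2 * m)"
  using level_less_iff[of 0 i] level_le_iff[of i "2 * m"] Suc_level[of "2 * m"] assms by auto

lemma threshold_le_iff:
  assumes "i \<in> {1..2 * m}" "j \<in> {1..2 * m}"
  shows "threshold N m i \<le> threshold N m j \<longleftrightarrow> j \<le> i"
  using avg_hard_valuation_le_iff[OF level_bounds[OF assms(1)] level_bounds[OF assms(2)]]
  by (simp add: threshold_def level_le_iff)

lemma threshold_less_iff:
  assumes "i \<in> {1..2 * m}" "j \<in> {1..2 * m}"
  shows "threshold N m i < threshold N m j \<longleftrightarrow> j < i"
  using threshold_le_iff[OF assms(2,1)] by (simp add: not_le[symmetric])

lemma threshold_bounds:
  assumes "i \<in> {1..2 * m}"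
  shows "0 < threshold N m i" "threshold N m i \<le> 2"
  using level_bounds[OF assms] by (auto simp: threshold_def avg_hard_valuation add_pos_nonneg)

lemma set_hard_history_subset: "set (hard_history N m) \<subseteq> hard_round N m ` {1..2 * m}"
  by (auto simp: hard_history_def simp del: upt_Suc)

lemma instance_hard: "auction_instance (N ^ (2 * m)) (hard_history N m) (hard_valuation N m)"
proof -
  have "\<exists>i\<in>set [1..<Suc (2 * m)]. replicate (N ^ (2 * m - i)) (hard_round N m i) \<noteq> []"
    using N m by (intro bexI[of _ 1]) auto
  then have "hard_history N m \<noteq> []"
    unfolding hard_history_def by (simp add: concat_eq_Nil_conv)
  moreover have "0 \<le> c" if i: "i \<in> {1..2 * m}" and c: "c \<in> set (hard_round N m i)" for i c
    using threshold_bounds(1)[OF i] c by (auto simp: hard_round_def split: if_splits)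
  ultimately show ?thesis
    using valuation_hard_valuation two_le_units set_hard_history_subset
    unfolding auction_instance_def by fastforce
qed

lemma total_value_hard_history:
  "total_value K (hard_history N m) v s =
     (\<Sum>i = 1..2 * m. real (N ^ (2 * m - i)) * value_won K v s (hard_round N m i))"
proof -
  have "total_value K (hard_history N m) v s =
      (\<Sum>i\<leftarrow>[1..<Suc (2 * m)]. real (N ^ (2 * m - i)) * value_won K v s (hard_round N m i))"
    unfolding hard_history_def total_value_concat_replicate ..
  then show ?thesis
    by (simp only: interv_sum_list_conv_sum_set_nat set_upt atLeastLessThanSuc_atLeastAtMost)
qed

section \<open>Outcome of the paired strategy; its block sizes telescope\<close>

lemma length_filter_paired_bids:
  assumes "J \<le> m" "\<And>j. j < m \<Longrightarrow> P (threshold N m (2 * j + 1)) \<longleftrightarrow> j < J"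
  shows "length (filter P (bid_vector (paired_strategy N m))) = level N (2 * J)"
proof -
  let ?q = "\<lambda>j. level N (2 * j + 2) - level N (2 * j)"
  have "length (filter P (bid_vector (paired_strategy N m))) = (\<Sum>j<m. if j < J then ?q j else 0)"
    unfolding length_filter_bid_vector using assms(2)
    by (auto simp: paired_strategy_def intro!: sum.cong)
  also have "\<dots> = (\<Sum>j<J. ?q j)"
    using assms(1) by (intro sum.mono_neutral_cong_right) auto
  also have "\<dots> = level N (2 * J)"
  proof (induction J)
    case (Suc J)
    then show ?case using level_le_iff[of "2 * J" "2 * J + 2"] by simp
  qed simp
  finally show ?thesis .
qed

lemma uniform_paired_strategy: "uniform_strategy (N ^ (2 * m) - 1) m (paired_strategy N m)"
proof -
  have "cum_quantity (paired_strategy N m) m = level N (2 * m)"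
    using length_filter_paired_bids[of m "\<lambda>_. True"] length_bid_vector[of "paired_strategy N m"]
    by (simp add: paired_strategy_def)
  then show ?thesis
    using m threshold_bounds(1)
    by (auto simp: uniform_strategy_def paired_strategy_def sorted_wrt_iff_nth_less
        threshold_less_iff level_less_iff level_def[of N "2 * m"])
qed

text \<open>In an even round exactly \<open>level N i\<close> own bids reach the threshold and
  rivals at the threshold take the other units. In an odd round more own bids reach it, but the
  rivals bidding \<open>3\<close> leave only \<open>level N i\<close> units.\<close>

lemma paired_strategy_round:
  assumes i: "i \<in> {1..2 * m}"
  shows "units_won (N ^ (2 * m)) (paired_strategy N m) (hard_round N m i) = level N i"
    and "price (N ^ (2 * m)) (paired_strategy N m) (hard_round N m i) \<le> threshold N m i"
proof -
  let ?K = "N ^ (2 * m)" and ?s = "paired_strategy N m" and ?cs = "hard_round N m i"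
  let ?\<theta> = "threshold N m i" and ?bs = "bid_vector (paired_strategy N m)"
  define p where "p = price ?K ?s ?cs"
  define x where "x = units_won ?K ?s ?cs"
  have K: "1 \<le> ?K" using two_le_units by simp
  have nonneg: "\<forall>b\<in>set ?bs. 0 \<le> b"
    using uniform_strategyD(5)[OF uniform_paired_strategy] by (auto simp: less_imp_le)
  note clear = market_clearing[OF K nonneg, of ?cs, folded p_def x_def]
  note lev = level_bounds[OF i]
  have \<theta>: "?\<theta> \<le> 2" by (rule threshold_bounds(2)[OF i])
  have rivals: "?K \<le> length (filter (\<lambda>c. ?\<theta> \<le> c) ?cs)" "length ?cs = ?K"
    using \<theta> lev by (auto simp: hard_round_def)
  have p_ge: "?\<theta> \<le> p"
    unfolding p_def by (rule price_ge[OF K nonneg rivals(1)])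
  have x_from: "x \<le> length (filter (\<lambda>b. ?\<theta> \<le> b) ?bs)"
    using clear(2) length_filter_mono[of ?bs "\<lambda>b. p \<le> b" "\<lambda>b. ?\<theta> \<le> b"] p_ge by fastforce
  have "p \<le> ?\<theta> \<and> x = level N i"
  proof (cases "even i")
    case True
    then obtain J where J: "i = 2 * J" by blast
    have own: "length (filter (\<lambda>b. ?\<theta> \<le> b) ?bs) = level N i"
      unfolding J using i J by (intro length_filter_paired_bids) (auto simp: threshold_le_iff)
    have above: "length (filter (\<lambda>c. ?\<theta> < c) ?cs) = 0"
      using True by (simp add: hard_round_def)
    have "level N i \<le> x"
      unfolding x_def using own above lev by (intro units_won_ge[where a = ?\<theta>]) auto
    \<comment> \<open>Above the threshold there is no rival bid, so own bids would have to fill all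
      \<open>K\<close> units, while at most \<open>level N i\<close> of them win.\<close>
    moreover have "p \<le> ?\<theta>"
    proof (rule ccontr)
      assume "\<not> p \<le> ?\<theta>"
      then have "filter (\<lambda>c. p \<le> c) ?cs = []"
        using True by (auto simp: hard_round_def filter_empty_conv)
      then show False
        using clear(4) rivals(2) x_from own lev by simp
    qed
    ultimately show ?thesis using x_from own by simp
  next
    case False
    then obtain J where J: "i = 2 * J + 1" by (elim oddE)
    have own: "length (filter (\<lambda>b. ?\<theta> \<le> b) ?bs) = level N (2 * Suc J)"
      using i J by (intro length_filter_paired_bids) (auto simp: threshold_le_iff)
    have own': "length (filter (\<lambda>b. ?\<theta> < b) ?bs) = level N (2 * J)"
      using i J by (intro length_filter_paired_bids) (auto simp: threshold_less_iff)
    have above: "length (filter (\<lambda>c. ?\<theta> < c) ?cs) = ?K - level N i"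
      using False \<theta> by (simp add: hard_round_def)
    have x_ge: "level N i \<le> x"
      unfolding x_def using own above lev J level_le_iff[of i "2 * Suc J"]
      by (intro units_won_ge[where a = ?\<theta>]) auto
    \<comment> \<open>A higher price would exclude block \<open>J\<close>, which bids exactly the
      threshold, and leave only \<open>level N (2 * J)\<close> own bids.\<close>
    have p: "p \<le> ?\<theta>"
    proof (rule ccontr)
      assume "\<not> p \<le> ?\<theta>"
      then have "x \<le> level N (2 * J)"
        using clear(2) length_filter_mono[of ?bs "\<lambda>b. p \<le> b" "\<lambda>b. ?\<theta> < b"] own' by fastforce
      then show False
        using x_ge level_le_iff[of i "2 * J"] J by simp
    qed
    then have "x + (?K - level N i) \<le> ?K"
      using clear(3) above p_ge by simp
    then show ?thesis using p x_ge lev by simp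
  qed
  then show "units_won ?K ?s ?cs = level N i" "price ?K ?s ?cs \<le> ?\<theta>"
    by (simp_all add: x_def p_def)
qed

lemma value_won_paired_strategy:
  assumes "i \<in> {1..2 * m}"
  shows "value_won (N ^ (2 * m)) (hard_valuation N m) (paired_strategy N m) (hard_round N m i) = real N ^ i"
  unfolding value_won_def paired_strategy_round[OF assms]
  using level_bounds[OF assms] by (simp add: sum_take_hard_valuation real_level)

text \<open>In round \<open>i\<close> the price is at most the break-even price of the
  \<open>level N i\<close> units won.\<close>

lemma paired_strategy_feasible:
  "paired_strategy N m \<in> feasible_class m (N ^ (2 * m)) (hard_history N m) (hard_valuation N m)"
proof -
  have "payment (N ^ (2 * m)) (paired_strategy N m) (hard_round N m i)
      \<le> value_won (N ^ (2 * m)) (hard_valuation N m) (paired_strategy N m) (hard_round N m i)"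
    if i: "i \<in> {1..2 * m}" for i
  proof -
    have "payment (N ^ (2 * m)) (paired_strategy N m) (hard_round N m i)
        \<le> threshold N m i * real (level N i)"
      unfolding payment_def paired_strategy_round(1)[OF i]
      by (intro mult_right_mono paired_strategy_round(2)[OF i]) simp
    also have "\<dots> = real N ^ i"
      using level_bounds[OF i] real_level[of i]
      by (simp add: threshold_def avg_hard_valuation field_simps)
    finally show ?thesis by (simp add: value_won_paired_strategy[OF i])
  qed
  then have "\<forall>cs\<in>set (hard_history N m). payment (N ^ (2 * m)) (paired_strategy N m) cs
      \<le> value_won (N ^ (2 * m)) (hard_valuation N m) (paired_strategy N m) cs"
    using set_hard_history_subset by blast
  then show ?thesis
    using uniform_paired_strategy unfolding feasible_class_def length_hard_valuation by blast
qed

lemma total_value_paired_strategy: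
  "total_value (N ^ (2 * m)) (hard_history N m) (hard_valuation N m) (paired_strategy N m)
     = 2 * real m * real N ^ (2 * m)"
proof -
  have "total_value (N ^ (2 * m)) (hard_history N m) (hard_valuation N m) (paired_strategy N m)
      = (\<Sum>i = 1..2 * m. real N ^ (2 * m))"
    unfolding total_value_hard_history
    by (intro sum.cong) (simp_all add: value_won_paired_strategy power_add[symmetric])
  then show ?thesis by simp
qed

text \<open>A safe block ending in the quantity \<open>Q\<close> is useful only in the round \<open>i\<close> with
  \<open>level N (i - 1) < Q \<le> level N i\<close>: it does not win in earlier rounds, and its value is
  negligible compared to \<open>level N j\<close> for later rounds \<open>j\<close>.\<close>

lemma total_value_safe_le:
  assumes s: "s \<in> safe_class m (N ^ (2 * m)) (hard_history N m) (hard_valuation N m)"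
  shows "total_value (N ^ (2 * m)) (hard_history N m) (hard_valuation N m) s
    \<le> (1 + 2 / real N) * real m * real N ^ (2 * m)"
proof -
  let ?K = "N ^ (2 * m)" and ?v = "hard_valuation N m"
  obtain k where k: "k \<le> m" "uniform_strategy (length ?v) k s"
    and bids: "\<And>l. l < k \<Longrightarrow> fst (s ! l) = avg_value ?v (cum_quantity s (Suc l))"
    using s by (auto simp: safe_class_def)
  define Q where "Q l = cum_quantity s (Suc l)" for l
  define G where "G = {i \<in> {1..2 * m}. \<exists>l<k. level N (i - 1) < Q l \<and> Q l \<le> level N i}"
  note U = uniform_strategyD[OF k(2)]
  have nonneg: "\<forall>b\<in>set (bid_vector s). 0 \<le> b" using U(5) by (auto simp: less_imp_le)
  have Q_bounds: "1 \<le> Q l" "Q l < ?K" if "l < k" for l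
  proof -
    have "0 < snd (s ! l)"
      using k(2) that U(1) nth_mem[of l s] by (auto simp: uniform_strategy_def case_prod_unfold)
    then show "1 \<le> Q l" by (simp add: Q_def cum_quantity_def)
    have "Q l \<le> cum_quantity s k"
      unfolding Q_def cum_quantity_def using that by (intro sum_mono2) auto
    then show "Q l < ?K"
      using k(2) two_le_units by (auto simp: uniform_strategy_def length_hard_valuation)
  qed
  \<comment> \<open>The price is at least the threshold, so only blocks with
    \<open>Q l \<le> level N i\<close> can win. If none of them ends in the window of round
    \<open>i\<close>, they all end by \<open>level N (i - 1)\<close>.\<close>
  have units: "units_won ?K s (hard_round N m i) \<le> (if i \<in> G then level N i else level N (i - 1))"
    if i: "i \<in> {1..2 * m}" for i
  proof -
    let ?cs = "hard_round N m i" and ?\<theta> = "threshold N m i"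
    define z where "z = (if i \<in> G then level N i else level N (i - 1))"
    have "?K \<le> length (filter (\<lambda>c. ?\<theta> \<le> c) ?cs)"
      using threshold_bounds(2)[OF i] level_bounds[OF i] by (auto simp: hard_round_def)
    then have "?\<theta> \<le> price ?K s ?cs"
      using two_le_units nonneg by (intro price_ge) auto
    then have "units_won ?K s ?cs \<le> length (filter (\<lambda>b. ?\<theta> \<le> b) (bid_vector s))"
      using own_from_price[of ?K s ?cs] two_le_units nonneg
        length_filter_mono[of "bid_vector s" "\<lambda>b. price ?K s ?cs \<le> b" "\<lambda>b. ?\<theta> \<le> b"]
      by fastforce
    also have "\<dots> = (\<Sum>l<k. if ?\<theta> \<le> fst (s ! l) then snd (s ! l) else 0)"
      unfolding length_filter_bid_vector U(1) ..
    also have "\<dots> \<le> (\<Sum>l<k. if Q l \<le> z then snd (s ! l) else 0)"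
    proof (intro sum_mono)
      fix l assume "l \<in> {..<k}"
      then have l: "l < k" by simp
      then have "?\<theta> \<le> fst (s ! l) \<longleftrightarrow> Q l \<le> level N i"
        using bids[OF l] Q_bounds[OF l] level_bounds[OF i]
        by (simp add: threshold_def avg_hard_valuation_le_iff Q_def)
      moreover have "Q l \<le> z" if "Q l \<le> level N i"
      proof (cases "i \<in> G")
        case False
        then have "\<not> level N (i - 1) < Q l"
          using that l i unfolding G_def by blast
        then show ?thesis using False by (simp add: z_def)
      qed (use that in \<open>simp add: z_def\<close>)
      ultimately show "(if ?\<theta> \<le> fst (s ! l) then snd (s ! l) else 0) \<le> (if Q l \<le> z then snd (s ! l) else 0)"
        by simp
    qed
    also have "\<dots> \<le> z"
      unfolding Q_def cum_quantity_def by (rule sum_small_partial_sums_le)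
    finally show ?thesis by (simp add: z_def)
  qed
  \<comment> \<open>After weighting, a round in \<open>G\<close> yields at most
    \<open>N ^ (2 * m)\<close>; any other round wins value at most \<open>N ^ (i - 1)\<close> and
    loses a factor \<open>N\<close>.\<close>
  have term_le: "real (N ^ (2 * m - i)) * value_won ?K ?v s (hard_round N m i)
      \<le> (if i \<in> G then real N ^ (2 * m) else 0) + real N ^ (2 * m) / real N"
    if i: "i \<in> {1..2 * m}" for i
  proof -
    let ?j = "if i \<in> G then i else i - 1"
    have "units_won ?K s (hard_round N m i) \<le> level N ?j"
      using units[OF i] by (simp split: if_splits)
    then have "value_won ?K ?v s (hard_round N m i) \<le> real (level N ?j) + 1"
      unfolding value_won_def
      using sum_take_hard_valuation_le[of "units_won ?K s (hard_round N m i)"] by linarith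
    also have "\<dots> = real N ^ ?j" by (rule real_level)
    finally have "real (N ^ (2 * m - i)) * value_won ?K ?v s (hard_round N m i)
        \<le> real N ^ (2 * m - i) * real N ^ ?j"
      by (simp add: mult_left_mono)
    also have "\<dots> = real N ^ (2 * m - i + ?j)"
      by (simp add: power_add)
    also have "\<dots> \<le> (if i \<in> G then real N ^ (2 * m) else 0) + real N ^ (2 * m) / real N"
    proof (cases "i \<in> G")
      case True
      then show ?thesis using i by simp
    next
      case False
      then have "2 * m - i + ?j = 2 * m - 1" using i by auto
      then show ?thesis using False N m by (simp add: power_diff)
    qed
    finally show ?thesis .
  qed
  \<comment> \<open>The windows of different rounds are disjoint, so each block accounts for at most
    one round in \<open>G\<close>, recovered as the least \<open>i\<close> with
    \<open>Q l \<le> level N i\<close>.\<close>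
  have "G \<subseteq> (\<lambda>l. LEAST i. Q l \<le> level N i) ` {..<k}"
  proof
    fix i assume "i \<in> G"
    then obtain l where l: "l < k" "1 \<le> i" "level N (i - 1) < Q l" "Q l \<le> level N i"
      by (auto simp: G_def)
    have "i \<le> j" if "Q l \<le> level N j" for j
      using l(2,3) that level_less_iff[of "i - 1" j] by linarith
    then have "(LEAST i. Q l \<le> level N i) = i"
      using l(4) by (intro Least_equality)
    then show "i \<in> (\<lambda>l. LEAST i. Q l \<le> level N i) ` {..<k}"
      using l(1) by auto
  qed
  then have "card G \<le> k"
    by (metis card_image_le card_lessThan card_mono finite_imageI finite_lessThan le_trans)
  then have G: "card G \<le> m" "G \<subseteq> {1..2 * m}" using k(1) by (auto simp: G_def)
  have "total_value ?K (hard_history N m) ?v s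
      \<le> (\<Sum>i = 1..2 * m. (if i \<in> G then real N ^ (2 * m) else 0) + real N ^ (2 * m) / real N)"
    unfolding total_value_hard_history by (intro sum_mono term_le)
  also have "\<dots> = real (card G) * real N ^ (2 * m) + 2 * real m * (real N ^ (2 * m) / real N)"
    using G(2) by (simp add: sum.distrib sum.inter_restrict[symmetric] Int_absorb1)
  also have "\<dots> \<le> real m * real N ^ (2 * m) + 2 * real m * (real N ^ (2 * m) / real N)"
    using G(1) by (intro add_right_mono mult_right_mono) auto
  also have "\<dots> = (1 + 2 / real N) * real m * real N ^ (2 * m)"
    by (simp add: algebra_simps)
  finally show ?thesis .
qed

text \<open>The totals are at least \<open>2 * W\<close> and at most \<open>(1 + 2 / N) * W\<close>,
  and \<open>(2 - 4 / N) * (1 + 2 / N) = 2 - 8 / N ^ 2\<close> is at most \<open>2\<close>.\<close>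

lemma value_ratio_hard_ge:
  "ereal (2 - 4 / real N) \<le> value_ratio (feasible_class m) (safe_class m)
     (N ^ (2 * m)) (hard_history N m) (hard_valuation N m)"
proof -
  let ?K = "N ^ (2 * m)" and ?H = "hard_history N m" and ?v = "hard_valuation N m"
  define F where "F = Max (total_value ?K ?H ?v ` feasible_class m ?K ?H ?v)"
  define S where "S = Max (total_value ?K ?H ?v ` safe_class m ?K ?H ?v)"
  define W where "W = real m * real N ^ (2 * m)"
  have W: "0 < W" using N m by (simp add: W_def)
  have "total_value ?K ?H ?v (paired_strategy N m) \<le> F"
    unfolding F_def using finite_total_values paired_strategy_feasible by (intro Max_ge) auto
  then have F: "2 * W \<le> F" by (simp add: total_value_paired_strategy W_def)
  have "safe_class m ?K ?H ?v \<noteq> {}"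
    using exists_safe_strategy[OF valuation_hard_valuation, of "{}" m ?K ?H] m by auto
  then have "S \<in> total_value ?K ?H ?v ` safe_class m ?K ?H ?v"
    unfolding S_def using finite_total_values by (intro Max_in) auto
  then have S: "0 \<le> S" "S \<le> (1 + 2 / real N) * W"
    using total_value_nonneg[OF valuation_hard_valuation] total_value_safe_le
    by (auto simp: W_def mult.assoc)
  have "ereal (2 - 4 / real N) \<le> ereal F / ereal S"
  proof (cases "S = 0")
    \<comment> \<open>A positive number divided by \<open>0\<close> is infinite in
      \<open>ereal\<close>, so the bound holds here too.\<close>
    case True
    moreover have "ereal F / 0 = \<infinity>" using F W by (simp add: divide_ereal_def)
    ultimately show ?thesis by (simp only: zero_ereal_def[symmetric] ereal_less_eq)
  next
    case False
    have "(2 - 4 / real N) * S \<le> (2 - 4 / real N) * ((1 + 2 / real N) * W)"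
      using N S(2) by (intro mult_left_mono) (simp_all add: field_simps)
    also have "\<dots> = 2 * W - 8 / real N ^ 2 * W"
      using N by (simp add: field_simps power2_eq_square)
    also have "\<dots> \<le> F" using F W by (smt (verit) divide_nonneg_nonneg mult_nonneg_nonneg zero_le_power2)
    finally show ?thesis using False S(1) by (simp add: le_divide_eq)
  qed
  then show ?thesis by (simp add: value_ratio_def F_def S_def)
qed

end

lemma exists_instance_value_ratio_ge:
  assumes m: "1 \<le> m" and "0 < \<delta>"
  shows "\<exists>K H v. auction_instance K H v
    \<and> ereal (2 - \<delta>) \<le> value_ratio (feasible_class m) (safe_class m) K H v"
proof -
  obtain n :: nat where n: "4 / \<delta> < real n" using reals_Archimedean2 by blast
  \<comment> \<open>The maximum with \<open>2\<close> meets the requirement on \<open>N\<close> in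
    the hard instance; \<open>n\<close> makes the loss \<open>4 / N\<close> at most
    \<open>\<delta>\<close>.\<close>
  define N where "N = max 2 n"
  have N: "2 \<le> N" "4 / \<delta> \<le> real N" using n by (auto simp: N_def)
  then have "4 / real N \<le> \<delta>" using assms(2) by (simp add: field_simps)
  then have "ereal (2 - \<delta>) \<le> ereal (2 - 4 / real N)" by simp
  then show ?thesis
    using instance_hard[OF N(1) m] value_ratio_hard_ge[OF N(1) m] order_trans by blast
qed

theorem mainTheorem8:
  fixes m :: nat
  assumes "1 \<le> m"
  shows "sup_value_ratio (feasible_class m) (safe_class m) \<le> 2
       \<and> (\<forall>\<delta>::real. 0 < \<delta> \<and> \<delta> \<le> 1/2 \<longrightarrow>
            (\<exists>K H v. auction_instance K H v
               \<and> ereal (2 - \<delta>) \<le> value_ratio (feasible_class m) (safe_class m) K H v))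
       \<and> richness_ratio (feasible_class m) (safe_class m) (1/2)"
proof -
  have le: "sup_value_ratio (feasible_class m) (safe_class m) \<le> 2"
    unfolding sup_value_ratio_def using value_ratio_le_2 assms by (intro Sup_least) auto
  moreover have "richness_ratio (feasible_class m) (safe_class m) (1/2)"
    unfolding richness_ratio_def
  proof (intro exI[of _ 2] conjI)
    show "\<forall>\<^sub>F \<delta> in at_right 0. \<exists>K H v. auction_instance K H v
        \<and> ereal (2 - \<delta>) \<le> value_ratio (feasible_class m) (safe_class m) K H v"
      using eventually_at_right_less
      by eventually_elim (rule exists_instance_value_ratio_ge[OF assms])
  qed (use le in simp_all)
  ultimately show ?thesis
    using exists_instance_value_ratio_ge[OF assms] by blast
qed

end
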